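(* Let $A\in\mathbb{R}^{n\times n}$ ($n\ge1$) be such that the directed graph $G$ of $A$ is strongly connected, and let $K\in\mathbb{N}$ be such that $\mathcal{C}_K\neq\emptyset$, where $\mathcal{C}_K=\{S\subset V : |S|=K,\ (A,B(S))\text{ is structurally controllable}\}$. Let $\tilde{\mathcal{C}}_K=\{\Omega : \exists\, S\in\mathcal{C}_K\text{ such that }\Omega\subset S\}$. Then $(V,\tilde{\mathcal{C}}_K)$ is a matroid (with $\tilde{\mathcal C}_K$ as the collection of independent sets).
   Context: $V=\{v_1,\dots,v_n\}$. The directed graph $G=(V,E)$ of $A$ has an edge $(v_j,v_i)\in E$ exactly when $A_{ij}\ne0$. For $S\subset V$, $B(S)\in\mathbb{R}^{n\times n}$ is the diagonal matrix whose $i$th diagonal entry is $1$ if $v_i\in S$ and $0$ otherwise. A pair $(\hat A,\hat B)$ of real $n\times n$ matrices is controllable if $[\hat B\ \ \hat A\hat B\ \cdots\ \hat A^{n-1}\hat B]$ has rank $n$. Two pairs $(A,B)$ and $(\hat A,\hat B)$ have the same structure if the matrices $[A\ B]$ and $[\hat A\ \hat B]$ have zeros at exactly the same entries. $(A,B(S))$ is structurally controllable if there is a controllable pair of real matrices having the same structure as $(A,B(S))$. *)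

theory Defs
  imports "Jordan_Normal_Form.DL_Rank" "Graph_Theory.Digraph_Component"
begin

(* The vertex v_(i+1) is represented by the row/column index i < n, so V is {..<n}. *)
definition matrix_digraph :: "nat \<Rightarrow> real mat \<Rightarrow> nat pair_pre_digraph" where
  "matrix_digraph n A =
     \<lparr>pverts = {..<n}, parcs = {(j, i). i < n \<and> j < n \<and> A $$ (i, j) \<noteq> 0}\<rparr>"

definition actuation_mat :: "nat \<Rightarrow> nat set \<Rightarrow> real mat" where
  "actuation_mat n S = mat n n (\<lambda>(i, j). if i = j \<and> i \<in> S then 1 else 0)"

(* The n x n^2 block matrix [B  AB  ...  A^(n-1)B]: column j lies in block j div n,
   where it is column j mod n. *)
definition controllability_mat :: "nat \<Rightarrow> real mat \<Rightarrow> real mat \<Rightarrow> real mat" where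
  "controllability_mat n A B =
     mat n (n * n) (\<lambda>(i, j). ((A ^\<^sub>m (j div n)) * B) $$ (i, j mod n))"

definition controllable :: "nat \<Rightarrow> real mat \<Rightarrow> real mat \<Rightarrow> bool" where
  "controllable n A B \<longleftrightarrow> vec_space.rank n (controllability_mat n A B) = n"

(* The block matrix [A B], for A and B with equally many rows. *)
definition append_cols :: "'a::zero mat \<Rightarrow> 'a mat \<Rightarrow> 'a mat" where
  "append_cols A B = four_block_mat A B (0\<^sub>m 0 (dim_col A)) (0\<^sub>m 0 (dim_col B))"

definition same_structure :: "nat \<Rightarrow> real mat \<Rightarrow> real mat \<Rightarrow> real mat \<Rightarrow> real mat \<Rightarrow> bool" where
  "same_structure n A B A' B' \<longleftrightarrow>
     (\<forall>i < n. \<forall>j < 2 * n. append_cols A B $$ (i, j) = 0 \<longleftrightarrow> append_cols A' B' $$ (i, j) = 0)"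

definition structurally_controllable :: "nat \<Rightarrow> real mat \<Rightarrow> real mat \<Rightarrow> bool" where
  "structurally_controllable n A B \<longleftrightarrow>
     (\<exists>A' \<in> carrier_mat n n. \<exists>B' \<in> carrier_mat n n.
        same_structure n A B A' B' \<and> controllable n A' B')"

definition controlling_sets :: "nat \<Rightarrow> real mat \<Rightarrow> nat \<Rightarrow> nat set set" where
  "controlling_sets n A K =
     {S. S \<subseteq> {..<n} \<and> card S = K \<and> structurally_controllable n A (actuation_mat n S)}"

definition controlling_subsets :: "nat \<Rightarrow> real mat \<Rightarrow> nat \<Rightarrow> nat set set" where
  "controlling_subsets n A K = {\<Omega>. \<exists>S \<in> controlling_sets n A K. \<Omega> \<subseteq> S}"

definition matroid :: "'a set \<Rightarrow> 'a set set \<Rightarrow> bool" where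
  "matroid V \<I> \<longleftrightarrow>
     finite V \<and> \<I> \<subseteq> Pow V \<and> {} \<in> \<I> \<and>
     (\<forall>X \<in> \<I>. \<forall>Y. Y \<subseteq> X \<longrightarrow> Y \<in> \<I>) \<and>
     (\<forall>X \<in> \<I>. \<forall>Y \<in> \<I>. card X < card Y \<longrightarrow> (\<exists>y \<in> Y - X. insert y X \<in> \<I>))"

end

theory Submission
  imports Defs
begin

text \<open>Call \<open>(i, j)\<close> an entry of the pattern of \<open>A\<close> if \<open>A $$ (i, j) \<noteq> 0\<close>. When the graph of \<open>A\<close>
is strongly connected, \<open>(A, B(S))\<close> is structurally controllable if and only if \<open>S\<close> is nonempty and
the rows outside \<open>S\<close> can be matched injectively to columns along the pattern; this is Lin's
criterion, specialised to the strongly connected case. So the members of \<open>\<C>\<^sub>K\<close> are the nonempty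
\<open>K\<close>-element sets whose complement is independent in the transversal matroid of the pattern. Such
sets satisfy the basis exchange axiom, because the complements do (\<open>matchable_exchange\<close>), and a
nonempty family of equicardinal sets with basis exchange spans a matroid
(\<open>matroid_if_basis_exchange\<close>).

Necessity of the matching condition: if \<open>(A', B')\<close> is controllable, no nonzero row vector kills both
\<open>A'\<close> and \<open>B'\<close>, so \<open>[A' B']\<close> has full row rank and a nonzero maximal minor. A nonzero term in the
Leibniz expansion of this minor is an injective choice of nonzero entries, one per row. In the rows
outside \<open>S\<close>, where \<open>B'\<close> vanishes, these entries lie in \<open>A'\<close>.

Sufficiency: it suffices to find weights \<open>a\<close>, supported in the pattern but allowed to vanish on parts
of it, for which only \<open>w = 0\<close> satisfies \<open>(w a\<^sup>k)\<^sub>s = 0\<close> for all \<open>k\<close> and all \<open>s \<in> S\<close>. Indeed that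
property is the nonvanishing of a determinant depending continuously on \<open>a\<close>, so it survives the
perturbation \<open>a + t A\<close> with small \<open>t \<noteq> 0\<close>, which has the exact pattern of \<open>A\<close>
(\<open>separates_perturb\<close>). The weights are found by following the matching backwards from each vertex.
The graph of the matching splits into paths that start in \<open>S\<close> and into cycles. On the paths, unit
weights do (\<open>separates_stems\<close>). The cycles are then attached one at a time: strong connectivity gives
an edge leaving the part treated so far, and a cycle hit by that edge can be given a weight \<open>\<gamma>\<close> so
large that its oscillation outgrows everything the earlier part could use to cancel it
(\<open>separates_attach_cycle\<close>).\<close>

section \<open>Matchings and basis exchange\<close>

definition matchable :: "('a \<times> 'b) set \<Rightarrow> 'a set \<Rightarrow> bool" where
  "matchable E I \<longleftrightarrow> (\<exists>f. inj_on f I \<and> (\<forall>i\<in>I. (i, f i) \<in> E))"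

text \<open>The vertices of the alternating walk from \<open>z\<close>: go along \<open>g\<close> to a column and return along \<open>f\<close>.\<close>
inductive_set alternating_reach :: "('a \<Rightarrow> 'b) \<Rightarrow> 'a set \<Rightarrow> ('a \<Rightarrow> 'b) \<Rightarrow> 'a set \<Rightarrow> 'a \<Rightarrow> 'a set"
  for f I g J z where
  start: "z \<in> alternating_reach f I g J z"
| step: "\<lbrakk>i \<in> alternating_reach f I g J z; i \<in> J; i' \<in> I; f i' = g i\<rbrakk>
    \<Longrightarrow> i' \<in> alternating_reach f I g J z"

text \<open>Let \<open>f\<close> match \<open>I\<close> and \<open>g\<close> match \<open>J\<close>. Switching from \<open>f\<close> to \<open>g\<close> along the alternating walk from
\<open>z\<close> never makes two rows compete for a column, and the walk, being deterministic, can leave \<open>J\<close> only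
at its last vertex. That vertex, if there is one, is the row given up for \<open>z\<close>. Otherwise \<open>I\<close>
together with \<open>z\<close> can be matched, and any row of \<open>I - J\<close> may be dropped.\<close>
lemma matchable_exchange:
  assumes fin: "finite I" "finite J" and card: "card I = card J"
    and mI: "matchable E I" and mJ: "matchable E J" and z: "z \<in> J - I"
  shows "\<exists>t \<in> I - J. matchable E (insert z (I - {t}))"
proof -
  obtain f where f: "inj_on f I" "\<forall>i\<in>I. (i, f i) \<in> E" using mI by (auto simp: matchable_def)
  obtain g where g: "inj_on g J" "\<forall>i\<in>J. (i, g i) \<in> E" using mJ by (auto simp: matchable_def)
  define R where "R = alternating_reach f I g J z"
  have zR: "z \<in> R" by (simp add: R_def alternating_reach.start)
  have RI: "R \<subseteq> insert z I"
  proof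
    fix i assume "i \<in> R"
    then show "i \<in> insert z I" unfolding R_def by cases auto
  qed
  have finR: "finite R" using RI fin by (meson finite_insert finite_subset)
  define h where "h = (\<lambda>i. if i \<in> R then g i else f i)"
  have "inj_on h ((I - R) \<union> (R \<inter> J))"
  proof (rule inj_onI)
    fix i j assume ij: "i \<in> (I - R) \<union> (R \<inter> J)" "j \<in> (I - R) \<union> (R \<inter> J)" and eq: "h i = h j"
    have cross: "f i' \<noteq> g i''" if "i' \<in> I - R" "i'' \<in> R \<inter> J" for i' i''
      using that alternating_reach.step[of i'' f I g J z i'] unfolding R_def by blast
    show "i = j"
      using ij eq cross f(1) g(1) unfolding h_def
      by (auto split: if_splits dest: inj_onD) (metis DiffI IntI)+
  qed
  then have mat: "matchable E ((I - R) \<union> (R \<inter> J))"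
    unfolding matchable_def h_def using f(2) g(2) by (intro exI[of _ h]) (auto simp: h_def)
  \<comment> \<open>Every vertex of the walk other than \<open>z\<close> is entered through \<open>g\<close> from a vertex in \<open>J\<close>.\<close>
  have "card (R - {z}) \<le> card (R \<inter> J)"
  proof -
    have "f ` (R - {z}) \<subseteq> g ` (R \<inter> J)"
    proof
      fix c assume "c \<in> f ` (R - {z})"
      then obtain i where i: "i \<in> R" "i \<noteq> z" "c = f i" by auto
      from i(1) obtain j where "j \<in> R" "j \<in> J" "f i = g j"
        unfolding R_def by cases (use i(2) in auto)
      then show "c \<in> g ` (R \<inter> J)" using i by auto
    qed
    then have "card (f ` (R - {z})) \<le> card (g ` (R \<inter> J))"
      by (intro card_mono) (use finR in auto)
    moreover have "inj_on f (R - {z})" using RI f(1) by (auto intro: inj_on_subset)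
    moreover have "inj_on g (R \<inter> J)" using g(1) by (auto intro: inj_on_subset)
    ultimately show ?thesis by (simp add: card_image)
  qed
  moreover have "card R = Suc (card (R - {z}))" using zR finR by (metis card_Suc_Diff1)
  moreover have "card R = card (R \<inter> J) + card (R - J)" using finR
    by (metis card_Int_Diff)
  ultimately have small: "card (R - J) \<le> 1" by linarith
  have "\<exists>t \<in> I - J. R - J \<subseteq> {t}"
  proof (cases "R - J = {}")
    case True
    have "card (I - J) = card (J - I)"
      using card fin by (metis card_Diff_subset_Int card_Int_Diff finite_Int add_left_cancel inf_commute)
    then have "card (I - J) \<noteq> 0" using z fin by auto
    then obtain t where "t \<in> I - J" by (metis card.empty ex_in_conv)
    then show ?thesis using True by auto
  next
    case False
    then obtain t where t: "t \<in> R - J" by auto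
    have "R - J \<subseteq> {t}" using small t finR
      by (metis One_nat_def card_le_Suc0_iff_eq finite_Diff singletonI subsetI)
    moreover have "t \<in> I - J" using t RI z by auto
    ultimately show ?thesis by auto
  qed
  then obtain t where t: "t \<in> I - J" "R - J \<subseteq> {t}" by auto
  have "insert z (I - {t}) \<subseteq> (I - R) \<union> (R \<inter> J)" using t zR z by auto
  then have "matchable E (insert z (I - {t}))"
    using mat unfolding matchable_def by (meson inj_on_subset subsetD)
  then show ?thesis using t(1) by blast
qed

text \<open>To augment \<open>X\<close> by an element of \<open>Y \<subseteq> T\<close>, take a basis \<open>S \<supseteq> X\<close> that meets \<open>T\<close> as much as
possible. Basis exchange then forces \<open>S - T \<subseteq> X\<close>, and if \<open>S\<close> contained no element of \<open>Y - X\<close>,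
counting would give \<open>card Y \<le> card X\<close>.\<close>
lemma matroid_if_basis_exchange:
  assumes V: "finite V" and sub: "\<And>S. S \<in> \<B> \<Longrightarrow> S \<subseteq> V" and card: "\<And>S. S \<in> \<B> \<Longrightarrow> card S = K"
    and ne: "\<B> \<noteq> {}"
    and exch: "\<And>S T z. \<lbrakk>S \<in> \<B>; T \<in> \<B>; z \<in> S - T\<rbrakk> \<Longrightarrow> \<exists>t \<in> T - S. insert t (S - {z}) \<in> \<B>"
  shows "matroid V {\<Omega>. \<exists>S \<in> \<B>. \<Omega> \<subseteq> S}"
  unfolding matroid_def
proof (intro conjI ballI allI impI)
  show "finite V" by fact
  show "{\<Omega>. \<exists>S \<in> \<B>. \<Omega> \<subseteq> S} \<subseteq> Pow V" using sub by blast
  show "{} \<in> {\<Omega>. \<exists>S \<in> \<B>. \<Omega> \<subseteq> S}" using ne by blast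
  show "Y \<in> {\<Omega>. \<exists>S \<in> \<B>. \<Omega> \<subseteq> S}" if "X \<in> {\<Omega>. \<exists>S \<in> \<B>. \<Omega> \<subseteq> S}" "Y \<subseteq> X" for X Y
    using that by blast
next
  fix X Y assume X: "X \<in> {\<Omega>. \<exists>S \<in> \<B>. \<Omega> \<subseteq> S}" and Y: "Y \<in> {\<Omega>. \<exists>S \<in> \<B>. \<Omega> \<subseteq> S}"
    and lt: "card X < card Y"
  obtain T where T: "T \<in> \<B>" "Y \<subseteq> T" using Y by auto
  have finB: "finite S" if "S \<in> \<B>" for S using sub[OF that] V finite_subset by blast
  define P where "P = (\<lambda>S. S \<in> \<B> \<and> X \<subseteq> S)"
  have "\<exists>S. P S" using X by (auto simp: P_def)
  then obtain S where S: "P S" and max: "\<And>S'. P S' \<Longrightarrow> card (S' \<inter> T) \<le> card (S \<inter> T)"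
    using ex_has_greatest_nat[of P _ "\<lambda>S. card (S \<inter> T)" "Suc (card T)"] finB[OF T(1)]
    by (metis card_mono inf_le2 le_imp_less_Suc)
  have SB: "S \<in> \<B>" "X \<subseteq> S" using S by (auto simp: P_def)
  have ST: "S - T \<subseteq> X"
  proof (rule ccontr)
    assume "\<not> S - T \<subseteq> X"
    then obtain z where z: "z \<in> S - T" "z \<notin> X" by auto
    obtain t where t: "t \<in> T - S" "insert t (S - {z}) \<in> \<B>" using exch[OF SB(1) T(1) z(1)] by auto
    have "P (insert t (S - {z}))" using t(2) SB(2) z(2) by (auto simp: P_def)
    moreover have "insert t (S - {z}) \<inter> T = insert t (S \<inter> T)" using t z by auto
    ultimately show False using max[of "insert t (S - {z})"] t finB[OF SB(1)] by auto
  qed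
  show "\<exists>y \<in> Y - X. insert y X \<in> {\<Omega>. \<exists>S \<in> \<B>. \<Omega> \<subseteq> S}"
  proof (cases "\<exists>y \<in> Y - X. y \<in> S")
    case True then show ?thesis using SB by blast
  next
    case False
    have finX: "finite X" "finite Y" using SB T finB by (meson finite_subset)+
    have "Y - X \<subseteq> T - S" using False T by auto
    then have "card (Y - X) \<le> card (T - S)" using finB[OF T(1)] by (simp add: card_mono)
    also have "card (T - S) = card (S - T)"
      using card[OF SB(1)] card[OF T(1)] finB[OF SB(1)] finB[OF T(1)]
      by (metis card_Diff_subset_Int finite_Int inf_commute)
    also have "\<dots> \<le> card (X - Y)" using ST T(2) finX(1) by (intro card_mono) auto
    finally have "card Y \<le> card X" using finX
      by (metis card_Int_Diff inf_commute nat_add_left_cancel_le)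
    then show ?thesis using lt by simp
  qed
qed

section \<open>Weights on walks and separation of row vectors\<close>

text \<open>The entries of the \<open>k\<close>th power of the matrix \<open>a\<close>. Weights are functions rather than matrices so
that they can be modified entrywise while the index set \<open>{..<n}\<close> stays fixed.\<close>
fun walk_weight :: "nat \<Rightarrow> (nat \<Rightarrow> nat \<Rightarrow> real) \<Rightarrow> nat \<Rightarrow> nat \<Rightarrow> nat \<Rightarrow> real" where
  "walk_weight n a 0 i j = (if i = j then 1 else 0)"
| "walk_weight n a (Suc k) i j = (\<Sum>l<n. a i l * walk_weight n a k l j)"

text \<open>The row vector \<open>w a\<^sup>k\<close>.\<close>
definition row_orbit :: "nat \<Rightarrow> (nat \<Rightarrow> nat \<Rightarrow> real) \<Rightarrow> (nat \<Rightarrow> real) \<Rightarrow> nat \<Rightarrow> nat \<Rightarrow> real" where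
  "row_orbit n a w k j = (\<Sum>i<n. w i * walk_weight n a k i j)"

text \<open>For \<open>U = {..<n}\<close> this is controllability from \<open>S\<close>, stated dually and with all powers of \<open>a\<close>.
Partial sets \<open>U\<close> are needed because the weights are built up from a part of the graph.\<close>
definition separates :: "nat \<Rightarrow> (nat \<Rightarrow> nat \<Rightarrow> real) \<Rightarrow> nat set \<Rightarrow> nat set \<Rightarrow> bool" where
  "separates n a S U \<longleftrightarrow> (\<forall>w. (\<forall>k. \<forall>s\<in>S. row_orbit n a w k s = 0) \<longrightarrow> (\<forall>i\<in>U. w i = 0))"

lemma walk_weight_Suc_right:
  assumes "i < n" "j < n"
  shows "walk_weight n a (Suc k) i j = (\<Sum>l<n. walk_weight n a k i l * a l j)"
  using assms(1)
proof (induction k arbitrary: i)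
  case 0
  have "(\<Sum>l<n. a i l * (if l = j then 1 else 0)) = (\<Sum>l<n. if l = j then a i l else 0)"
    by (intro sum.cong) auto
  moreover have "(\<Sum>l<n. (if i = l then 1 else 0) * a l j) = (\<Sum>l<n. if l = i then a l j else 0)"
    by (intro sum.cong) auto
  ultimately show ?case using 0 assms(2) by (simp add: sum.delta)
next
  case (Suc k)
  have "walk_weight n a (Suc (Suc k)) i j
      = (\<Sum>l<n. a i l * (\<Sum>m<n. walk_weight n a k l m * a m j))"
    unfolding walk_weight.simps(2)[of n a "Suc k"] using Suc.IH by (intro sum.cong) auto
  also have "\<dots> = (\<Sum>m<n. \<Sum>l<n. a i l * walk_weight n a k l m * a m j)"
    unfolding sum_distrib_left by (subst sum.swap) (simp add: mult.assoc)
  finally show ?case by (simp add: sum_distrib_right)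
qed

lemma row_orbit_0: "j < n \<Longrightarrow> row_orbit n a w 0 j = w j"
proof -
  assume j: "j < n"
  have "row_orbit n a w 0 j = (\<Sum>i<n. if i = j then w i else 0)"
    unfolding row_orbit_def by (intro sum.cong) auto
  then show ?thesis using j by (simp add: sum.delta)
qed

lemma row_orbit_Suc:
  assumes "j < n"
  shows "row_orbit n a w (Suc k) j = (\<Sum>i<n. row_orbit n a w k i * a i j)"
proof -
  have "row_orbit n a w (Suc k) j = (\<Sum>i<n. w i * (\<Sum>l<n. walk_weight n a k i l * a l j))"
    unfolding row_orbit_def using walk_weight_Suc_right[OF _ assms] by (intro sum.cong) auto
  also have "\<dots> = (\<Sum>l<n. \<Sum>i<n. w i * walk_weight n a k i l * a l j)"
    unfolding sum_distrib_left by (subst sum.swap) (simp add: mult.assoc)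
  finally show ?thesis by (simp add: row_orbit_def sum_distrib_right)
qed

text \<open>The \<open>n + 1\<close> row vectors \<open>w, w a, \<dots>, w a\<^sup>n\<close> are linearly dependent. This weak form of
Cayley-Hamilton, with coefficients depending on \<open>w\<close>, is what allows powers below \<open>n\<close> to stand for
all powers.\<close>
lemma row_orbit_linear_recurrence:
  "\<exists>p\<le>n. \<exists>c. c p \<noteq> 0 \<and> (\<forall>j<n. (\<Sum>k\<le>p. c k * row_orbit n a w k j) = 0)"
proof -
  \<comment> \<open>The row vectors are the columns of \<open>N\<close>; a zero row in the last place makes \<open>N\<close> square.\<close>
  define N where "N = mat (Suc n) (Suc n) (\<lambda>(j, k). if j < n then row_orbit n a w k j else 0)"
  have N: "N \<in> carrier_mat (Suc n) (Suc n)" by (simp add: N_def)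
  have "(\<Prod>i = 0..<Suc n. N $$ (i, q i)) = 0" if q: "q permutes {0..<Suc n}" for q
  proof -
    have "N $$ (n, q n) = 0" using permutes_in_image[OF q, of n] by (simp add: N_def)
    then show ?thesis by (intro prod_zero) auto
  qed
  then have "det N = 0" unfolding det_def'[OF N] by (intro sum.neutral) auto
  then obtain v where v: "v \<in> carrier_vec (Suc n)" "v \<noteq> 0\<^sub>v (Suc n)" "N *\<^sub>v v = 0\<^sub>v (Suc n)"
    using det_0_iff_vec_prod_zero_field[OF N] by blast
  have "\<exists>k\<le>n. v $ k \<noteq> 0"
  proof (rule ccontr)
    assume "\<not> ?thesis"
    then have "v = 0\<^sub>v (Suc n)" using v(1) by (intro eq_vecI) auto
    then show False using v(2) by simp
  qed
  then have "{k. k \<le> n \<and> v $ k \<noteq> 0} \<noteq> {}" "finite {k. k \<le> n \<and> v $ k \<noteq> 0}" by auto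
  then obtain p where p: "p \<le> n \<and> v $ p \<noteq> 0" "\<And>k. k \<le> n \<and> v $ k \<noteq> 0 \<Longrightarrow> k \<le> p"
    using Max_in[of "{k. k \<le> n \<and> v $ k \<noteq> 0}"] Max_ge[of "{k. k \<le> n \<and> v $ k \<noteq> 0}"]
    by blast
  have "(\<Sum>k\<le>p. v $ k * row_orbit n a w k j) = 0" if j: "j < n" for j
  proof -
    have "0 = (N *\<^sub>v v) $ j" using v(3) j by simp
    also have "\<dots> = (\<Sum>k = 0..<Suc n. v $ k * row_orbit n a w k j)"
      using j v(1) by (auto simp: N_def scalar_prod_def mult.commute intro!: sum.cong)
    also have "\<dots> = (\<Sum>k\<le>p. v $ k * row_orbit n a w k j)"
    proof (rule sum.mono_neutral_right)
      show "\<forall>k\<in>{0..<Suc n} - {..p}. v $ k * row_orbit n a w k j = 0"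
        using p(2) by (metis DiffE atLeastLessThan_iff atMost_iff less_Suc_eq_le mult_eq_0_iff)
    qed (use p(1) in auto)
    finally show ?thesis by simp
  qed
  then show ?thesis using p(1) by (intro exI[of _ p] conjI exI[of _ "\<lambda>k. v $ k"]) auto
qed

lemma row_orbit_zero_if_zero_below:
  assumes S: "S \<subseteq> {..<n}" and zero: "\<And>k s. k < n \<Longrightarrow> s \<in> S \<Longrightarrow> row_orbit n a w k s = 0"
    and s: "s \<in> S"
  shows "row_orbit n a w k s = 0"
proof -
  obtain p c where p: "p \<le> n" "c p \<noteq> 0"
    and rec: "\<And>j. j < n \<Longrightarrow> (\<Sum>k\<le>p. c k * row_orbit n a w k j) = 0"
    using row_orbit_linear_recurrence[of n a w] by blast
  have shifted: "(\<Sum>k\<le>p. c k * row_orbit n a w (m + k) j) = 0" if "j < n" for m j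
    using that
  proof (induction m arbitrary: j)
    case 0 then show ?case using rec by simp
  next
    case (Suc m)
    have "(\<Sum>k\<le>p. c k * row_orbit n a w (Suc m + k) j)
        = (\<Sum>k\<le>p. \<Sum>i<n. c k * row_orbit n a w (m + k) i * a i j)"
      by (simp add: row_orbit_Suc[OF Suc.prems] sum_distrib_left mult.assoc)
    also have "\<dots> = (\<Sum>i<n. (\<Sum>k\<le>p. c k * row_orbit n a w (m + k) i) * a i j)"
      unfolding sum_distrib_right by (rule sum.swap)
    also have "\<dots> = 0" using Suc.IH by (intro sum.neutral) auto
    finally show ?case .
  qed
  have sn: "s < n" using s S by auto
  show ?thesis
  proof (induction k rule: less_induct)
    case (less k)
    show ?case
    proof (cases "k < p")
      case True then show ?thesis using zero s p(1) by simp
    next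
      case False
      have "(\<Sum>l\<le>p. c l * row_orbit n a w (k - p + l) s)
          = (\<Sum>l<p. c l * row_orbit n a w (k - p + l) s) + c p * row_orbit n a w k s"
        using False by (simp add: lessThan_Suc_atMost[symmetric])
      also have "(\<Sum>l<p. c l * row_orbit n a w (k - p + l) s) = 0"
        using less.IH False by (intro sum.neutral) auto
      finally show ?thesis using shifted[OF sn, of "k - p"] p(2) by simp
    qed
  qed
qed

section \<open>Separating weights on a strongly connected graph\<close>

text \<open>Attach to \<open>U\<close> a cycle \<open>C\<close>, which \<open>f\<close> runs through against the direction of the edges, by an edge
of weight \<open>1\<close> from \<open>u \<in> U\<close> to \<open>v \<in> C\<close>. Let \<open>r\<^sub>k\<close> be the orbit of a row vector \<open>w\<close> that vanishes at \<open>S\<close>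
for all \<open>k\<close>. On \<open>C\<close> the orbit rotates and is multiplied by \<open>\<gamma>\<close>, so \<open>\<bar>r\<^sub>k v\<bar>\<close> attains \<open>\<gamma>\<^sup>k M\<close>
periodically, where \<open>M\<close> is the maximum of \<open>\<bar>w\<bar>\<close> on \<open>C\<close>. On the other hand, if \<open>d\<close> is the least length
of a walk of nonzero total weight from some \<open>s \<in> S\<close> to \<open>u\<close>, the vanishing of the orbit at \<open>s\<close> expresses
\<open>r\<^sub>k v\<close> through the values of \<open>r\<^sub>k\<close> on \<open>U\<close>: the bound is \<open>\<bar>r\<^sub>k v\<bar> \<le> D \<nu>\<^sub>k\<close>, with \<open>\<nu>\<^sub>k\<close> the sum of
\<open>\<bar>r\<^sub>k\<bar>\<close> over \<open>U\<close> and \<open>D\<close> independent of \<open>\<gamma>\<close>. But \<open>\<nu>\<^sub>k\<close> is driven only by \<open>r\<^sub>k v\<close> and, up to a term of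
growth rate \<open>R < \<gamma>\<close>, is at most \<open>\<gamma>\<^sup>k M / (\<gamma> - R)\<close>. For large \<open>\<gamma>\<close> this is incompatible with \<open>M > 0\<close>.
Hence \<open>w\<close> vanishes on \<open>C\<close>, and separation on \<open>U\<close> takes care of the rest.\<close>
lemma separates_attach_cycle:
  assumes U: "U \<subseteq> {..<n}" and S: "S \<subseteq> U" and supp: "\<And>i j. a i j \<noteq> 0 \<Longrightarrow> i \<in> U \<and> j \<in> U"
    and sep: "separates n a S U" and u: "u \<in> U" and C: "C \<subseteq> {..<n} - U"
    and bij: "bij_betw f C C" and v: "v \<in> C" and ret: "\<And>i. i \<in> C \<Longrightarrow> \<exists>k. (f ^^ k) i = v"
  shows "\<exists>\<gamma>. separates n (\<lambda>i j. a i j + (if i = v \<and> j = u then 1 else 0)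
      + (if i \<in> C \<and> j = f i then \<gamma> else 0)) S (U \<union> C)"
proof -
  have finU: "finite U" and finC: "finite C" using U C by (auto intro: finite_subset)
  have fC: "f i \<in> C" if "i \<in> C" for i using bij that by (auto simp: bij_betw_def)
  have uv: "u < n" "v < n" "v \<notin> U" using U C u v by auto
  \<comment> \<open>Otherwise the unit row vector at \<open>u\<close> would contradict separation on \<open>U\<close>.\<close>
  have "\<exists>k. \<exists>s\<in>S. walk_weight n a k u s \<noteq> 0"
  proof (rule ccontr)
    assume "\<not> ?thesis"
    then have "\<forall>k. \<forall>s\<in>S. row_orbit n a (\<lambda>i. if i = u then 1 else 0) k s = 0"
      unfolding row_orbit_def by (auto intro!: sum.neutral)
    then show False using sep u unfolding separates_def by fastforce
  qed
  then obtain k s where ks: "s \<in> S" "walk_weight n a k u s \<noteq> 0" by auto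
  define d where "d = (LEAST k. walk_weight n a k u s \<noteq> 0)"
  define y where "y = walk_weight n a d u s"
  have y: "y \<noteq> 0" unfolding y_def d_def using ks(2) by (rule LeastI)
  have yless: "walk_weight n a l u s = 0" if "l < d" for l
    using not_less_Least that unfolding d_def by blast
  have sU: "s \<in> U" "s < n" using ks S U by auto
  define R where "R = (\<Sum>i<n. \<Sum>j<n. \<bar>a i j\<bar>)"
  have R0: "R \<ge> 0" unfolding R_def by (intro sum_nonneg) auto
  define D where "D = (\<Sum>j\<in>U. \<bar>walk_weight n a (Suc d) j s\<bar>) / \<bar>y\<bar>"
  have D0: "D \<ge> 0" unfolding D_def by (intro divide_nonneg_nonneg sum_nonneg) auto
  \<comment> \<open>Chosen so that \<open>D / (\<gamma> - R) \<le> 1 / 2\<close>.\<close>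
  define \<gamma> where "\<gamma> = R + 2 * D + 1"
  have \<gamma>: "\<gamma> > 0" "\<gamma> > R" using R0 D0 by (auto simp: \<gamma>_def)
  define a' where "a' = (\<lambda>i j. a i j + (if i = v \<and> j = u then 1 else 0)
      + (if i \<in> C \<and> j = f i then \<gamma> else 0))"
  have "separates n a' S (U \<union> C)"
    unfolding separates_def
  proof (intro allI impI)
    fix w assume "\<forall>k. \<forall>s\<in>S. row_orbit n a' w k s = 0"
    then have ann: "row_orbit n a' w k s = 0" if "s \<in> S" for k s using that by blast
    define r where "r = row_orbit n a' w"
    have r0: "r 0 j = w j" if "j < n" for j unfolding r_def using that by (rule row_orbit_0)
    have rC: "r (Suc k) (f i) = \<gamma> * r k i" if "i \<in> C" for k i
    proof -
      have fi: "f i \<in> C" "f i < n" "f i \<notin> U" using fC[OF that] C by auto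
      have "a l (f i) = 0" "f i \<noteq> u" for l using supp[of l "f i"] fi u by auto
      moreover have "l \<in> C \<and> f i = f l \<longleftrightarrow> l = i" for l
        using that inj_on_eq_iff[OF bij_betw_imp_inj_on[OF bij] that, of l] by auto
      ultimately have "a' l (f i) = (if l = i then \<gamma> else 0)" for l
        unfolding a'_def by simp
      then have "r (Suc k) (f i) = (\<Sum>l<n. if l = i then r k l * \<gamma> else 0)"
        unfolding r_def row_orbit_Suc[OF fi(2)] by (intro sum.cong) auto
      then show ?thesis using that C by (auto simp: sum.delta)
    qed
    have rU: "r (Suc k) j = (\<Sum>i\<in>U. r k i * a i j) + (if j = u then r k v else 0)"
      if "j \<in> U" for k j
    proof -
      have jn: "j < n" using that U by auto
      have "r k i * a' i j = r k i * a i j + (if i = v then (if j = u then r k v else 0) else 0)" for i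
      proof -
        have "\<not> (i \<in> C \<and> j = f i)" using that C fC by blast
        then have "a' i j = a i j + (if i = v \<and> j = u then 1 else 0)"
          unfolding a'_def by (simp only: if_False add_0_right)
        then show ?thesis by (simp add: distrib_left)
      qed
      then have "r (Suc k) j
          = (\<Sum>i<n. r k i * a i j) + (\<Sum>i<n. if i = v then (if j = u then r k v else 0) else 0)"
        unfolding r_def row_orbit_Suc[OF jn] by (simp add: sum.distrib)
      also have "(\<Sum>i<n. r k i * a i j) = (\<Sum>i\<in>U. r k i * a i j)"
        using U supp by (intro sum.mono_neutral_right) auto
      finally show ?thesis using uv by (simp add: sum.delta)
    qed
    \<comment> \<open>The pairing of the orbit at time \<open>k\<close>, restricted to \<open>U\<close>, with the \<open>l\<close>th state reached from \<open>t\<close>.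
      Moving one step from the state to the orbit costs the term fed in through the edge \<open>(u, v)\<close>.\<close>
    define F where "F = (\<lambda>t k l. \<Sum>j\<in>U. r k j * walk_weight n a l j t)"
    have F0: "F t k 0 = 0" if "t \<in> S" for t k
    proof -
      have "F t k 0 = (\<Sum>j\<in>U. if j = t then r k j else 0)"
        unfolding F_def by (intro sum.cong) auto
      then show ?thesis using that S finU ann by (auto simp: sum.delta r_def)
    qed
    have FSuc: "F t k (Suc l) = F t (Suc k) l - r k v * walk_weight n a l u t" for t k l
    proof -
      have "F t (Suc k) l = (\<Sum>j\<in>U. (\<Sum>i\<in>U. r k i * a i j) * walk_weight n a l j t)
          + (\<Sum>j\<in>U. if j = u then r k v * walk_weight n a l j t else 0)"
        unfolding F_def sum.distrib[symmetric] by (intro sum.cong) (auto simp: rU algebra_simps)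
      also have "(\<Sum>j\<in>U. if j = u then r k v * walk_weight n a l j t else 0)
          = r k v * walk_weight n a l u t"
        using finU u by (simp add: sum.delta)
      also have "(\<Sum>j\<in>U. (\<Sum>i\<in>U. r k i * a i j) * walk_weight n a l j t)
          = (\<Sum>i\<in>U. r k i * (\<Sum>j\<in>U. a i j * walk_weight n a l j t))"
        unfolding sum_distrib_left sum_distrib_right
        by (subst sum.swap) (simp add: mult.assoc)
      also have "\<dots> = F t k (Suc l)" unfolding F_def
      proof (intro sum.cong refl arg_cong2[where f = "(*)"])
        show "(\<Sum>j\<in>U. a i j * walk_weight n a l j t) = walk_weight n a (Suc l) i t" for i
          unfolding walk_weight.simps using U supp by (intro sum.mono_neutral_left) auto
      qed
      finally show ?thesis by simp
    qed
    have Fd: "F s k l = 0" if "l \<le> d" for k l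
      using that
    proof (induction l arbitrary: k)
      case 0 show ?case using F0 ks by simp
    next
      case (Suc l) then show ?case using FSuc[of s k l] yless[of l] by simp
    qed
    define \<nu> where "\<nu> = (\<lambda>k. \<Sum>j\<in>U. \<bar>r k j\<bar>)"
    have \<nu>0: "\<nu> k \<ge> 0" for k unfolding \<nu>_def by (intro sum_nonneg) auto
    have key: "\<bar>r k v\<bar> \<le> D * \<nu> k" for k
    proof -
      have "\<bar>r k v\<bar> * \<bar>y\<bar> = \<bar>F s k (Suc d)\<bar>"
        using FSuc[of s k d] Fd[of d "Suc k"] by (simp add: y_def abs_mult)
      also have "\<dots> \<le> (\<Sum>j\<in>U. \<bar>r k j\<bar> * \<bar>walk_weight n a (Suc d) j s\<bar>)"
        unfolding F_def abs_mult[symmetric] by (rule sum_abs)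
      also have "\<dots> \<le> (\<Sum>j\<in>U. \<bar>r k j\<bar> * (\<Sum>j\<in>U. \<bar>walk_weight n a (Suc d) j s\<bar>))"
        using finU by (intro sum_mono mult_left_mono member_le_sum) auto
      also have "\<dots> = D * \<nu> k * \<bar>y\<bar>"
        using y by (simp add: D_def \<nu>_def sum_distrib_right[symmetric])
      finally show ?thesis using y by simp
    qed
    define M where "M = Max ((\<lambda>i. \<bar>w i\<bar>) ` C)"
    have wM: "\<bar>w i\<bar> \<le> M" if "i \<in> C" for i unfolding M_def using that finC by auto
    have "M \<in> (\<lambda>i. \<bar>w i\<bar>) ` C" unfolding M_def using finC v by (intro Max_in) auto
    then obtain i0 where i0: "i0 \<in> C" "\<bar>w i0\<bar> = M" by auto
    have M0: "M \<ge> 0" using i0 by auto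
    have rM: "\<bar>r k j\<bar> \<le> \<gamma> ^ k * M" if "j \<in> C" for k j
      using that
    proof (induction k arbitrary: j)
      case 0 then show ?case using r0[of j] wM C by auto
    next
      case (Suc k)
      then obtain i where i: "i \<in> C" "j = f i" using bij by (auto simp: bij_betw_def)
      show ?case using Suc.IH[OF i(1)] rC[OF i(1)] i(2) \<gamma> by (simp add: abs_mult)
    qed
    have r_iter: "r k ((f ^^ k) i) = \<gamma> ^ k * w i \<and> (f ^^ k) i \<in> C" if "i \<in> C" for k i
      by (induction k) (use that C r0[of i] rC fC in auto)
    have step: "\<nu> (Suc k) \<le> R * \<nu> k + \<gamma> ^ k * M" for k
    proof -
      have "\<nu> (Suc k) \<le> (\<Sum>j\<in>U. (\<Sum>i\<in>U. \<bar>r k i\<bar> * \<bar>a i j\<bar>) + (if j = u then \<bar>r k v\<bar> else 0))"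
        unfolding \<nu>_def
      proof (rule sum_mono)
        fix j assume "j \<in> U"
        have "\<bar>\<Sum>i\<in>U. r k i * a i j\<bar> \<le> (\<Sum>i\<in>U. \<bar>r k i\<bar> * \<bar>a i j\<bar>)"
          unfolding abs_mult[symmetric] by (rule sum_abs)
        then show "\<bar>r (Suc k) j\<bar> \<le> (\<Sum>i\<in>U. \<bar>r k i\<bar> * \<bar>a i j\<bar>) + (if j = u then \<bar>r k v\<bar> else 0)"
          unfolding rU[OF \<open>j \<in> U\<close>] by auto
      qed
      also have "\<dots> = (\<Sum>i\<in>U. \<bar>r k i\<bar> * (\<Sum>j\<in>U. \<bar>a i j\<bar>)) + \<bar>r k v\<bar>"
        unfolding sum.distrib sum_distrib_left using finU u
        by (subst sum.swap) (simp add: sum.delta)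
      also have "\<dots> \<le> (\<Sum>i\<in>U. \<bar>r k i\<bar> * R) + \<gamma> ^ k * M"
      proof (intro add_mono sum_mono mult_left_mono)
        fix i assume i: "i \<in> U"
        have "(\<Sum>j\<in>U. \<bar>a i j\<bar>) \<le> (\<Sum>j<n. \<bar>a i j\<bar>)" using U by (intro sum_mono2) auto
        also have "\<dots> \<le> R" unfolding R_def
          using i U by (intro member_le_sum[where f = "\<lambda>i. \<Sum>j<n. \<bar>a i j\<bar>"] sum_nonneg) auto
        finally show "(\<Sum>j\<in>U. \<bar>a i j\<bar>) \<le> R" .
      qed (use rM v in auto)
      finally show ?thesis by (simp add: \<nu>_def sum_distrib_left mult.commute)
    qed
    have growth: "\<nu> k \<le> R ^ k * \<nu> 0 + M * \<gamma> ^ k / (\<gamma> - R)" for k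
    proof (induction k)
      case 0 show ?case using \<gamma> M0 by simp
    next
      case (Suc k)
      have "\<nu> (Suc k) \<le> R * (R ^ k * \<nu> 0 + M * \<gamma> ^ k / (\<gamma> - R)) + \<gamma> ^ k * M"
        using step[of k] mult_left_mono[OF Suc R0] by linarith
      also have "\<dots> = R ^ Suc k * \<nu> 0 + M * \<gamma> ^ Suc k / (\<gamma> - R)"
        using \<gamma> by (simp add: field_simps)
      finally show ?case .
    qed
    obtain k0 where k0: "(f ^^ k0) i0 = v" using ret[OF i0(1)] by auto
    obtain k1 where k1: "(f ^^ k1) (f v) = v" using ret[OF fC[OF v]] by auto
    have per: "(f ^^ (q * Suc k1)) v = v" for q
    proof (induction q)
      case (Suc q)
      have "(f ^^ (Suc q * Suc k1)) v = (f ^^ (q * Suc k1)) ((f ^^ Suc k1) v)"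
        by (metis add.commute comp_apply funpow_add mult_Suc)
      then show ?case using Suc k1 by (simp add: funpow_swap1)
    qed simp
    \<comment> \<open>Compare the two estimates at the times when the maximum \<open>M\<close> has been rotated to \<open>v\<close>.\<close>
    have half: "M / 2 \<le> D * \<nu> 0 * (R / \<gamma>) ^ q" for q
    proof -
      define k where "k = q * Suc k1 + k0"
      have "(f ^^ k) i0 = v" unfolding k_def using per k0 by (simp add: funpow_add)
      then have "\<bar>r k v\<bar> = \<gamma> ^ k * M" using r_iter[OF i0(1), of k] i0(2) \<gamma> by (simp add: abs_mult)
      then have "\<gamma> ^ k * M \<le> D * (R ^ k * \<nu> 0 + M * \<gamma> ^ k / (\<gamma> - R))"
        using key[of k] mult_left_mono[OF growth[of k] D0] by linarith
      also have "\<dots> = D * \<nu> 0 * R ^ k + D / (\<gamma> - R) * (M * \<gamma> ^ k)" by (simp add: algebra_simps)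
      also have "D / (\<gamma> - R) * (M * \<gamma> ^ k) \<le> 1 / 2 * (M * \<gamma> ^ k)"
        by (intro mult_right_mono) (use M0 \<gamma> D0 in \<open>auto simp: \<gamma>_def field_simps\<close>)
      finally have "M / 2 * \<gamma> ^ k \<le> D * \<nu> 0 * R ^ k"
        by (simp add: algebra_simps)
      then have "M / 2 \<le> D * \<nu> 0 * (R / \<gamma>) ^ k" using \<gamma> by (simp add: field_simps power_divide)
      also have "\<dots> \<le> D * \<nu> 0 * (R / \<gamma>) ^ q"
        by (intro mult_left_mono power_decreasing) (use D0 \<nu>0 R0 \<gamma> in \<open>auto simp: k_def\<close>)
      finally show ?thesis .
    qed
    have "(\<lambda>q. D * \<nu> 0 * (R / \<gamma>) ^ q) \<longlonglongrightarrow> D * \<nu> 0 * 0"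
      using R0 \<gamma> by (intro tendsto_mult_left LIMSEQ_power_zero) auto
    then have "M / 2 \<le> D * \<nu> 0 * 0" by (rule LIMSEQ_le_const) (use half in blast)
    then have wC: "w i = 0" if "i \<in> C" for i using wM[OF that] by simp
    have rv: "r k v = 0" for k using rM[OF v, of k] M0 \<open>M / 2 \<le> D * \<nu> 0 * 0\<close> by simp
    \<comment> \<open>With the cycle silent, the orbit on \<open>U\<close> is an orbit of the original weights.\<close>
    have Fzero: "F t k l = 0" if "t \<in> S" for t k l
      by (induction l arbitrary: k) (use F0 FSuc rv that in auto)
    have "row_orbit n a w k t = 0" if t: "t \<in> S" for k t
    proof -
      have out: "walk_weight n a k i t = 0" if "i \<notin> U" for i
      proof -
        have "a i l = 0" for l using supp that by blast
        then show ?thesis using that t S by (cases k) auto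
      qed
      have "row_orbit n a w k t = (\<Sum>i\<in>U. w i * walk_weight n a k i t)"
        unfolding row_orbit_def using U out by (intro sum.mono_neutral_right) auto
      also have "\<dots> = F t 0 k" unfolding F_def using U r0 by (intro sum.cong) auto
      finally show ?thesis using Fzero[OF t] by simp
    qed
    then show "\<forall>i\<in>U \<union> C. w i = 0" using sep wC unfolding separates_def by blast
  qed
  then show ?thesis unfolding a'_def by blast
qed

text \<open>An injective self-map of a finite set permutes it, so every point lies on a cycle.\<close>
lemma orbit_of_injective_map:
  assumes fin: "finite W" and inj: "inj_on f W" and fW: "f ` W \<subseteq> W" and v: "v \<in> W"
  defines "C \<equiv> range (\<lambda>k. (f ^^ k) v)"
  shows "C \<subseteq> W" "v \<in> C" "bij_betw f C C" "\<And>i. i \<in> C \<Longrightarrow> \<exists>k. (f ^^ k) i = v"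
proof -
  have "(f ^^ k) v \<in> W" for k using v fW by (induction k) auto
  then show CW: "C \<subseteq> W" unfolding C_def by auto
  have "(f ^^ 0) v \<in> C" unfolding C_def by (rule rangeI)
  then show vC: "v \<in> C" by simp
  have fC: "f ` C \<subseteq> C"
  proof
    fix y assume "y \<in> f ` C"
    then obtain k where "y = (f ^^ Suc k) v" unfolding C_def by auto
    then show "y \<in> C" unfolding C_def by blast
  qed
  have finC: "finite C" using fin CW finite_subset by blast
  have injC: "inj_on f C" using inj CW inj_on_subset by blast
  then have img: "f ` C = C" using endo_inj_surj[OF finC fC] by simp
  then show "bij_betw f C C" using injC by (simp add: bij_betw_def)
  obtain p where p: "(f ^^ Suc p) v = v"
  proof -
    obtain c where c: "c \<in> C" "v = f c" using img vC by blast
    then obtain k where "c = (f ^^ k) v" unfolding C_def by blast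
    then have "(f ^^ Suc k) v = v" using c(2) by simp
    then show ?thesis by (rule that)
  qed
  have per: "(f ^^ (q * Suc p)) v = v" for q
  proof (induction q)
    case (Suc q)
    have "(f ^^ (Suc q * Suc p)) v = (f ^^ (q * Suc p)) ((f ^^ Suc p) v)"
      by (metis add.commute comp_apply funpow_add mult_Suc)
    then show ?case using Suc p by simp
  qed simp
  show "\<exists>k. (f ^^ k) i = v" if ic: "i \<in> C" for i
  proof -
    obtain j where j: "i = (f ^^ j) v" using ic unfolding C_def by blast
    have "(f ^^ (j * p)) i = (f ^^ (j * p + j)) v" by (simp add: j funpow_add)
    also have "j * p + j = j * Suc p" by simp
    finally show ?thesis using per by metis
  qed
qed

text \<open>The rows from which iterating \<open>f\<close> eventually reaches \<open>S\<close> lie on disjoint paths that start in \<open>S\<close>.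
With unit weights there, the coordinate of \<open>w\<close> at distance \<open>k\<close> along a path shows up at its starting
point in \<open>w a\<^sup>k\<close>. The remaining rows are mapped into themselves by \<open>f\<close> and hence form cycles.\<close>
lemma separates_stems:
  assumes S: "S \<subseteq> {..<n}" and inj: "inj_on f ({..<n} - S)"
    and fE: "\<And>i. i \<in> {..<n} - S \<Longrightarrow> (i, f i) \<in> E" and E: "E \<subseteq> {..<n} \<times> {..<n}"
  shows "\<exists>U a. S \<subseteq> U \<and> U \<subseteq> {..<n} \<and> f ` ({..<n} - U) \<subseteq> {..<n} - U
    \<and> (\<forall>i j. a i j \<noteq> 0 \<longrightarrow> (i, j) \<in> E \<and> i \<in> U \<and> j \<in> U) \<and> separates n a S U"
proof -
  define W where "W = {i. \<forall>k. (f ^^ k) i \<in> {..<n} - S}"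
  have WS: "W \<subseteq> {..<n} - S" unfolding W_def by (auto dest: spec[of _ 0])
  have fW: "f i \<in> W \<longleftrightarrow> i \<in> W" if "i \<in> {..<n} - S" for i
  proof
    assume "f i \<in> W"
    then have "(f ^^ k) i \<in> {..<n} - S" for k
      using that by (cases k) (auto simp: W_def funpow_swap1)
    then show "i \<in> W" by (simp add: W_def)
  next
    assume i: "i \<in> W"
    have "(f ^^ k) (f i) \<in> {..<n} - S" for k
    proof -
      have "(f ^^ Suc k) i \<in> {..<n} - S" using i unfolding W_def by blast
      then show ?thesis by (simp add: funpow_swap1)
    qed
    then show "f i \<in> W" by (simp add: W_def)
  qed
  define U where "U = {..<n} - W"
  have VU: "{..<n} - U = W" using WS by (auto simp: U_def)
  have fn: "f i < n" if "i \<in> {..<n} - S" for i using fE[OF that] E by auto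
  define a :: "nat \<Rightarrow> nat \<Rightarrow> real" where "a = (\<lambda>i j. if i \<in> U - S \<and> j = f i then 1 else 0)"
  have supp: "(i, j) \<in> E \<and> i \<in> U \<and> j \<in> U" if "a i j \<noteq> 0" for i j
  proof -
    have i: "i \<in> U - S" "j = f i" using that by (auto simp: a_def split: if_splits)
    then have "i \<in> {..<n} - S" "i \<notin> W" by (auto simp: U_def)
    then show ?thesis using i fE fW fn by (auto simp: U_def)
  qed
  have "separates n a S U" unfolding separates_def
  proof (intro allI impI ballI)
    fix w i assume ann: "\<forall>k. \<forall>s\<in>S. row_orbit n a w k s = 0" and i: "i \<in> U"
    have step: "row_orbit n a w (Suc k) (f l) = row_orbit n a w k l" if l: "l \<in> U - S" for k l
    proof -
      have lV: "l \<in> {..<n} - S" using l by (auto simp: U_def)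
      have "m \<in> U - S \<and> f l = f m \<longleftrightarrow> m = l" for m
      proof
        assume m: "m \<in> U - S \<and> f l = f m"
        then have "m \<in> {..<n} - S" by (auto simp: U_def)
        then show "m = l" using m lV inj_onD[OF inj] by metis
      qed (use l in auto)
      then have "a m (f l) = (if m = l then 1 else 0)" for m by (simp add: a_def)
      then have "row_orbit n a w (Suc k) (f l)
          = (\<Sum>m<n. if m = l then row_orbit n a w k m else 0)"
        unfolding row_orbit_Suc[OF fn[OF lV]] by (intro sum.cong) auto
      then show ?thesis using lV by (simp add: sum.delta)
    qed
    obtain k where "(f ^^ k) i \<notin> {..<n} - S" using i by (auto simp: U_def W_def)
    then show "w i = 0" using i
    proof -
      have "row_orbit n a w j i = 0" if "(f ^^ k) i \<notin> {..<n} - S" "i \<in> U" for i j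
        using that
      proof (induction k arbitrary: i j)
        case 0
        then show ?case using ann by (auto simp: U_def)
      next
        case (Suc k)
        show ?case
        proof (cases "i \<in> S")
          case True then show ?thesis using ann by blast
        next
          case False
          then have i: "i \<in> {..<n} - S" "i \<in> U - S" using Suc.prems(2) by (auto simp: U_def)
          then have "f i \<in> U" using fn[OF i(1)] fW[OF i(1)] by (auto simp: U_def)
          moreover have "(f ^^ k) (f i) \<notin> {..<n} - S" using Suc.prems(1) by (simp add: funpow_swap1)
          ultimately have "row_orbit n a w (Suc j) (f i) = 0" using Suc.IH by blast
          then show ?thesis using step[OF i(2)] by simp
        qed
      qed
      then have "row_orbit n a w 0 i = 0"
        using \<open>(f ^^ k) i \<notin> {..<n} - S\<close> i by blast
      then show ?thesis using i row_orbit_0[of i n a w] by (simp add: U_def)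
    qed
  qed
  moreover have "f ` W \<subseteq> W" using fW WS by blast
  moreover have "S \<subseteq> U" using S WS by (auto simp: U_def)
  ultimately show ?thesis using supp VU by (intro exI[of _ U] exI[of _ a]) (auto simp: U_def)
qed

text \<open>Induction on the number of rows outside \<open>U\<close>: an edge out of \<open>U\<close> enters a cycle of \<open>f\<close>, and that
cycle is attached to \<open>U\<close>.\<close>
lemma separates_extend_to_all:
  assumes E: "E \<subseteq> {..<n} \<times> {..<n}"
    and cross: "\<And>U. U \<noteq> {} \<Longrightarrow> U \<subset> {..<n} \<Longrightarrow> \<exists>u\<in>U. \<exists>v\<in>{..<n} - U. (v, u) \<in> E"
    and S: "S \<noteq> {}" and inj: "inj_on f ({..<n} - S)"
    and fE: "\<And>i. i \<in> {..<n} - S \<Longrightarrow> (i, f i) \<in> E"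
    and U: "S \<subseteq> U" "U \<subseteq> {..<n}" "f ` ({..<n} - U) \<subseteq> {..<n} - U"
    and supp: "\<And>i j. a i j \<noteq> 0 \<Longrightarrow> (i, j) \<in> E \<and> i \<in> U \<and> j \<in> U"
    and sep: "separates n a S U"
  shows "\<exists>a. (\<forall>i j. a i j \<noteq> 0 \<longrightarrow> (i, j) \<in> E) \<and> separates n a S {..<n}"
  using U supp sep
proof (induction "card ({..<n} - U)" arbitrary: U a rule: less_induct)
  case less
  show ?case
  proof (cases "U = {..<n}")
    case True
    have "separates n a S {..<n}" using less.prems(5) True by simp
    then show ?thesis using less.prems(4) by (intro exI[of _ a]) simp
  next
    case False
    let ?W = "{..<n} - U"
    have "U \<noteq> {}" "U \<subset> {..<n}" using S less.prems(1,2) False by auto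
    then obtain u v where uv: "u \<in> U" "v \<in> ?W" "(v, u) \<in> E" using cross by blast
    have injW: "inj_on f ?W" using inj less.prems(1) by (auto intro: inj_on_subset)
    define C where "C = range (\<lambda>k. (f ^^ k) v)"
    note orb = orbit_of_injective_map[OF _ injW less.prems(3) uv(2), folded C_def]
    have C: "C \<subseteq> ?W" "v \<in> C" "bij_betw f C C" using orb(1-3) by auto
    have ret: "\<exists>k. (f ^^ k) i = v" if "i \<in> C" for i using orb(4) that by simp
    obtain \<gamma> where sep': "separates n (\<lambda>i j. a i j + (if i = v \<and> j = u then 1 else 0)
      + (if i \<in> C \<and> j = f i then \<gamma> else 0)) S (U \<union> C)"
      using separates_attach_cycle[OF less.prems(2,1) _ less.prems(5) uv(1) C(1,3,2) ret] less.prems(4)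
      by blast
    define a' where "a' = (\<lambda>i j. a i j + (if i = v \<and> j = u then 1 else 0)
      + (if i \<in> C \<and> j = f i then \<gamma> else 0))"
    have supp': "(i, j) \<in> E \<and> i \<in> U \<union> C \<and> j \<in> U \<union> C" if nz: "a' i j \<noteq> 0" for i j
    proof -
      consider "a i j \<noteq> 0" | "i = v" "j = u" | "i \<in> C" "j = f i"
        using nz unfolding a'_def by (auto split: if_splits)
      then show ?thesis
      proof cases
        case 3
        then have "i \<in> {..<n} - S" using C(1) less.prems(1) by auto
        then show ?thesis using 3 fE C(3) by (auto simp: bij_betw_def)
      qed (use less.prems(4) uv C in auto)
    qed
    have rest: "{..<n} - (U \<union> C) = ?W - C" by blast
    have "f ` ({..<n} - (U \<union> C)) = f ` ?W - f ` C"
      using inj_on_image_set_diff[OF injW Diff_subset C(1)] by (simp only: rest)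
    then have img: "f ` ({..<n} - (U \<union> C)) \<subseteq> {..<n} - (U \<union> C)"
      using less.prems(3) C(3) by (auto simp: bij_betw_def)
    have "card ({..<n} - (U \<union> C)) < card ?W"
      using C(2) uv(2) by (intro psubset_card_mono) auto
    from less.hyps[OF this _ _ img supp' sep'[folded a'_def]] show ?thesis
      using less.prems(1,2) C(1) by auto
  qed
qed

lemma ex_separating_weights:
  assumes E: "E \<subseteq> {..<n} \<times> {..<n}"
    and cross: "\<And>U. U \<noteq> {} \<Longrightarrow> U \<subset> {..<n} \<Longrightarrow> \<exists>u\<in>U. \<exists>v\<in>{..<n} - U. (v, u) \<in> E"
    and S: "S \<noteq> {}" "S \<subseteq> {..<n}" and mat: "\<exists>f. inj_on f ({..<n} - S) \<and> (\<forall>i\<in>{..<n} - S. (i, f i) \<in> E)"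
  shows "\<exists>a. (\<forall>i j. a i j \<noteq> 0 \<longrightarrow> (i, j) \<in> E) \<and> separates n a S {..<n}"
proof -
  obtain f where f: "inj_on f ({..<n} - S)" "\<And>i. i \<in> {..<n} - S \<Longrightarrow> (i, f i) \<in> E"
    using mat by blast
  obtain U a where U: "S \<subseteq> U" "U \<subseteq> {..<n}" "f ` ({..<n} - U) \<subseteq> {..<n} - U"
    and a: "\<forall>i j. a i j \<noteq> 0 \<longrightarrow> (i, j) \<in> E \<and> i \<in> U \<and> j \<in> U" "separates n a S U"
    using separates_stems[OF S(2) f E] by blast
  show ?thesis
    by (rule separates_extend_to_all[OF E cross S(1) f U _ a(2)]) (use a(1) in auto)
qed

section \<open>Perturbation to the full zero pattern\<close>

text \<open>The finite-horizon controllability Gramian of the pair formed by \<open>a\<close> and the inputs \<open>S\<close>. Its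
determinant turns separation into a condition that is open in \<open>a\<close>.\<close>
definition gramian :: "nat \<Rightarrow> (nat \<Rightarrow> nat \<Rightarrow> real) \<Rightarrow> nat set \<Rightarrow> real mat" where
  "gramian n a S = mat n n
     (\<lambda>(i, j). \<Sum>k<n. \<Sum>s\<in>S. walk_weight n a k i s * walk_weight n a k j s)"

text \<open>The quadratic form of the Gramian at \<open>v\<close> is the sum of the squares of the values \<open>(v a\<^sup>k)\<^sub>s\<close> with
\<open>k < n\<close>.\<close>
lemma separates_iff_det_gramian:
  assumes S: "S \<subseteq> {..<n}"
  shows "separates n a S {..<n} \<longleftrightarrow> det (gramian n a S) \<noteq> 0"
proof -
  let ?G = "gramian n a S"
  have G: "?G \<in> carrier_mat n n" by (simp add: gramian_def)
  have finS: "finite S" using S finite_subset by blast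
  have Gv: "(?G *\<^sub>v v) $ i = (\<Sum>k<n. \<Sum>s\<in>S. walk_weight n a k i s * row_orbit n a (\<lambda>j. v $ j) k s)"
    if "v \<in> carrier_vec n" "i < n" for v i
  proof -
    have "(?G *\<^sub>v v) $ i
        = (\<Sum>j<n. \<Sum>k<n. \<Sum>s\<in>S. walk_weight n a k i s * (v $ j * walk_weight n a k j s))"
      using that by (auto simp: gramian_def scalar_prod_def sum_distrib_left sum_distrib_right
          atLeast0LessThan algebra_simps intro!: sum.cong)
    also have "\<dots> = (\<Sum>k<n. \<Sum>j<n. \<Sum>s\<in>S. walk_weight n a k i s * (v $ j * walk_weight n a k j s))"
      by (rule sum.swap)
    also have "\<dots> = (\<Sum>k<n. \<Sum>s\<in>S. \<Sum>j<n. walk_weight n a k i s * (v $ j * walk_weight n a k j s))"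
      by (intro sum.cong refl sum.swap)
    finally show ?thesis by (simp add: row_orbit_def sum_distrib_left)
  qed
  show ?thesis
  proof
    assume sep: "separates n a S {..<n}"
    show "det ?G \<noteq> 0"
    proof
      assume "det ?G = 0"
      then obtain v where v: "v \<in> carrier_vec n" "v \<noteq> 0\<^sub>v n" "?G *\<^sub>v v = 0\<^sub>v n"
        using det_0_iff_vec_prod_zero_field[OF G] by blast
      let ?r = "row_orbit n a (\<lambda>j. v $ j)"
      have "0 = (\<Sum>i<n. v $ i * (?G *\<^sub>v v) $ i)" using v(3) by simp
      also have "\<dots> = (\<Sum>i<n. \<Sum>k<n. \<Sum>s\<in>S. v $ i * walk_weight n a k i s * ?r k s)"
        by (simp add: Gv[OF v(1)] sum_distrib_left mult.assoc del: index_mult_mat_vec)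
      also have "\<dots> = (\<Sum>k<n. \<Sum>i<n. \<Sum>s\<in>S. v $ i * walk_weight n a k i s * ?r k s)"
        by (rule sum.swap)
      also have "\<dots> = (\<Sum>k<n. \<Sum>s\<in>S. \<Sum>i<n. v $ i * walk_weight n a k i s * ?r k s)"
        by (intro sum.cong refl sum.swap)
      also have "\<dots> = (\<Sum>k<n. \<Sum>s\<in>S. ?r k s * ?r k s)"
        unfolding sum_distrib_right[symmetric] by (simp add: row_orbit_def)
      finally have tot: "(\<Sum>k<n. \<Sum>s\<in>S. ?r k s * ?r k s) = 0" by simp
      have "?r k s = 0" if ks: "k < n" "s \<in> S" for k s
      proof -
        have "(\<Sum>s\<in>S. ?r k s * ?r k s) = 0"
          using tot ks(1) by (subst (asm) sum_nonneg_eq_0_iff) (auto intro: sum_nonneg)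
        then have "?r k s * ?r k s = 0"
          using ks(2) finS by (subst (asm) sum_nonneg_eq_0_iff) auto
        then show ?thesis by simp
      qed
      then have "?r k s = 0" if "s \<in> S" for k s
        using row_orbit_zero_if_zero_below[OF S] that by blast
      then have "\<forall>i<n. v $ i = 0" using sep unfolding separates_def by blast
      then have "v = 0\<^sub>v n" using v(1) by (intro eq_vecI) auto
      then show False using v(2) by simp
    qed
  next
    assume det: "det ?G \<noteq> 0"
    show "separates n a S {..<n}" unfolding separates_def
    proof (intro allI impI ballI)
      fix w i assume w: "\<forall>k. \<forall>s\<in>S. row_orbit n a w k s = 0" and i: "i \<in> {..<n}"
      have "row_orbit n a (\<lambda>j. vec n w $ j) = row_orbit n a w"
        by (intro ext) (auto simp: row_orbit_def intro!: sum.cong)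
      then have "?G *\<^sub>v vec n w = 0\<^sub>v n"
        using w G by (intro eq_vecI) (simp_all add: Gv del: index_mult_mat_vec)
      then have "vec n w = 0\<^sub>v n"
        using det_0_iff_vec_prod_zero_field[OF G] det vec_carrier by blast
      then show "w i = 0" using i by (metis index_vec index_zero_vec(1) lessThan_iff)
    qed
  qed
qed

lemma tendsto_walk_weight:
  assumes "\<And>i j. ((\<lambda>t. \<alpha> t i j) \<longlongrightarrow> a i j) F"
  shows "((\<lambda>t. walk_weight n (\<alpha> t) k i j) \<longlongrightarrow> walk_weight n a k i j) F"
  by (induction k arbitrary: i) (auto intro!: tendsto_sum tendsto_mult assms)

lemma tendsto_det_gramian:
  assumes "\<And>i j. ((\<lambda>t. \<alpha> t i j) \<longlongrightarrow> a i j) F"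
  shows "((\<lambda>t. det (gramian n (\<alpha> t) S)) \<longlongrightarrow> det (gramian n a S)) F"
proof -
  have G: "gramian n b S \<in> carrier_mat n n" for b by (simp add: gramian_def)
  have "((\<lambda>t. gramian n (\<alpha> t) S $$ (i, j)) \<longlongrightarrow> gramian n a S $$ (i, j)) F"
    if "i < n" "j < n" for i j
    using that by (simp add: gramian_def)
      (intro tendsto_sum tendsto_mult tendsto_walk_weight assms)
  moreover have "p i < n" if "p permutes {0..<n}" "i < n" for p i
    using permutes_in_image[OF that(1), of i] that(2) by auto
  ultimately show ?thesis unfolding det_def'[OF G]
    by (intro tendsto_sum tendsto_mult tendsto_const tendsto_prod) auto
qed

text \<open>Along the line \<open>a + t b\<close>, for all small \<open>t \<noteq> 0\<close>, the Gramian stays invertible and no entry of the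
pattern of \<open>b\<close> vanishes.\<close>
lemma separates_perturb:
  fixes b :: "nat \<Rightarrow> nat \<Rightarrow> real"
  assumes S: "S \<subseteq> {..<n}" and sep: "separates n a S {..<n}"
    and supp: "\<And>i j. a i j \<noteq> 0 \<Longrightarrow> b i j \<noteq> 0"
  shows "\<exists>a'. separates n a' S {..<n} \<and> (\<forall>i<n. \<forall>j<n. a' i j = 0 \<longleftrightarrow> b i j = 0)"
proof -
  define \<alpha> where "\<alpha> = (\<lambda>t i j. a i j + t * b i j)"
  have lim: "((\<lambda>t. \<alpha> t i j) \<longlongrightarrow> a i j) (at 0)" for i j
    unfolding \<alpha>_def by (auto intro!: tendsto_eq_intros)
  have "eventually (\<lambda>t. det (gramian n (\<alpha> t) S) \<noteq> 0) (at 0)"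
    using tendsto_imp_eventually_ne[OF tendsto_det_gramian[of \<alpha> a "at 0", OF lim]]
      sep separates_iff_det_gramian[OF S] by blast
  moreover have ev: "eventually (\<lambda>t. \<alpha> t i j = 0 \<longleftrightarrow> b i j = 0) (at 0)" for i j
  proof (cases "a i j = 0")
    case True
    then show ?thesis unfolding \<alpha>_def by (auto simp: eventually_at_filter)
  next
    case False
    have "eventually (\<lambda>t. \<alpha> t i j \<noteq> 0) (at 0)" using tendsto_imp_eventually_ne[OF lim False] .
    then show ?thesis using supp[OF False] by (auto elim: eventually_mono)
  qed
  have "eventually (\<lambda>t. \<forall>i\<in>{..<n}. \<forall>j\<in>{..<n}. \<alpha> t i j = 0 \<longleftrightarrow> b i j = 0) (at 0)"
    by (intro eventually_ball_finite ballI ev) auto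
  ultimately have "eventually (\<lambda>t. det (gramian n (\<alpha> t) S) \<noteq> 0
      \<and> (\<forall>i\<in>{..<n}. \<forall>j\<in>{..<n}. \<alpha> t i j = 0 \<longleftrightarrow> b i j = 0)) (at (0::real))"
    by (rule eventually_conj)
  then obtain t :: real where "det (gramian n (\<alpha> t) S) \<noteq> 0"
    "\<forall>i\<in>{..<n}. \<forall>j\<in>{..<n}. \<alpha> t i j = 0 \<longleftrightarrow> b i j = 0"
    using eventually_happens'[OF at_neq_bot] by blast
  then show ?thesis using separates_iff_det_gramian[OF S] by (intro exI[of _ "\<alpha> t"]) auto
qed

section \<open>Full row rank\<close>

lemma (in vec_space) rank_independent_columns:
  assumes C: "C \<in> carrier_mat n m"
  obtains ts where "distinct ts" "set ts \<subseteq> set (cols C)" "lin_indpt (set ts)"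
    "length ts = rank C" "set (cols C) \<subseteq> span (set ts)"
proof -
  have cC: "set (cols C) \<subseteq> carrier_vec n" using cols_dim C by blast
  obtain T where T: "maximal T (\<lambda>T. T \<subseteq> set (cols C) \<and> lin_indpt T)"
    using maximal_exists[of "\<lambda>T. T \<subseteq> set (cols C) \<and> lin_indpt T" "card (set (cols C))" "{}"]
    by (meson List.finite_set card_mono empty_iff empty_subsetI finite_lin_indpt2 rev_finite_subset)
  have Tsub: "T \<subseteq> set (cols C)" "lin_indpt T" using T by (auto simp: maximal_def)
  have finT: "finite T" using Tsub finite_subset by blast
  obtain ts where ts: "set ts = T" "distinct ts" using finite_distinct_list[OF finT] by blast
  have "length ts = rank C" using rank_card_indpt[OF C T] ts distinct_card by metis
  moreover have "set (cols C) \<subseteq> span T"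
  proof
    fix c assume c: "c \<in> set (cols C)"
    show "c \<in> span T"
    proof (rule ccontr)
      assume nin: "c \<notin> span T"
      have TV: "T \<subseteq> carrier_vec n" and cV: "c \<in> carrier_vec n" using Tsub cC c by auto
      have "c \<notin> T" using nin span_mem TV by blast
      then have "lin_indpt (insert c T)"
        using lin_dep_iff_in_span[of T c] TV cV Tsub(2) nin by auto
      then have "insert c T = T"
        using T c Tsub unfolding maximal_def by blast
      then show False using \<open>c \<notin> T\<close> by blast
    qed
  qed
  ultimately show ?thesis using that ts Tsub by blast
qed

lemma (in vec_space) full_rank_invertible_selection:
  assumes C: "C \<in> carrier_mat n m" and rank: "rank C = n"
  obtains ts where "distinct ts" "set ts \<subseteq> set (cols C)" "length ts = n"
    "det (mat_of_cols n ts) \<noteq> 0"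
proof -
  obtain ts where ts: "distinct ts" "set ts \<subseteq> set (cols C)" "lin_indpt (set ts)" "length ts = n"
    using rank_independent_columns[OF C] rank by metis
  have "set ts \<subseteq> carrier_vec n" using ts(2) cols_dim C by blast
  then have "cols (mat_of_cols n ts) = ts" by simp
  moreover have N: "mat_of_cols n ts \<in> carrier_mat n n" using ts(4) by auto
  ultimately have "rank (mat_of_cols n ts) = n" using lin_indpt_full_rank[OF N] ts by simp
  then show ?thesis using that ts det_rank_iff[OF N] by blast
qed

text \<open>A nonzero maximal minor has a nonzero term in its Leibniz expansion.\<close>
lemma (in vec_space) full_rank_transversal:
  assumes C: "C \<in> carrier_mat n m" and rank: "rank C = n"
  shows "\<exists>h. inj_on h {..<n} \<and> (\<forall>i<n. h i < m \<and> C $$ (i, h i) \<noteq> 0)"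
proof -
  obtain ts where ts: "distinct ts" "set ts \<subseteq> set (cols C)" "length ts = n"
    "det (mat_of_cols n ts) \<noteq> 0"
    by (rule full_rank_invertible_selection[OF C rank])
  have N: "mat_of_cols n ts \<in> carrier_mat n n" using ts(3) by auto
  have "\<exists>c<m. ts ! j = col C c" if "j < n" for j
  proof -
    have "ts ! j \<in> set (cols C)" using ts(2,3) that nth_mem by blast
    then show ?thesis using C by (auto simp: cols_def)
  qed
  then obtain g where g: "\<And>j. j < n \<Longrightarrow> g j < m \<and> ts ! j = col C (g j)" by metis
  obtain p where p: "p permutes {0..<n}" "(\<Prod>i = 0..<n. mat_of_cols n ts $$ (i, p i)) \<noteq> 0"
  proof (rule ccontr)
    assume "\<not> thesis"
    then have "\<forall>p. p permutes {0..<n} \<longrightarrow> (\<Prod>i = 0..<n. mat_of_cols n ts $$ (i, p i)) = 0"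
      using that by blast
    then have "det (mat_of_cols n ts) = 0" unfolding det_def'[OF N] by (intro sum.neutral) auto
    then show False using ts(4) by simp
  qed
  have pn: "p i < n" if "i < n" for i using permutes_in_image[OF p(1), of i] that by auto
  have "inj_on (\<lambda>i. g (p i)) {..<n}"
  proof (rule inj_onI)
    fix i j assume ij: "i \<in> {..<n}" "j \<in> {..<n}" "g (p i) = g (p j)"
    then have "ts ! p i = ts ! p j" using g pn by (metis lessThan_iff)
    then have "p i = p j" using ts(1,3) pn ij by (simp add: nth_eq_iff_index_eq)
    then show "i = j" using permutes_inj[OF p(1)] by (simp add: inj_eq)
  qed
  moreover have "g (p i) < m \<and> C $$ (i, g (p i)) \<noteq> 0" if "i < n" for i
  proof -
    have "mat_of_cols n ts $$ (i, p i) \<noteq> 0" using p(2) that by auto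
    then show ?thesis using g[OF pn[OF that]] that pn[OF that] C ts(3)
      by (auto simp: mat_of_cols_index)
  qed
  ultimately show ?thesis by blast
qed

text \<open>If the columns span less than the whole space, a vector orthogonal to an independent spanning
selection of them is orthogonal to all.\<close>
lemma (in vec_space) full_rank_iff_left_kernel_trivial:
  assumes C: "C \<in> carrier_mat n m"
  shows "rank C = n \<longleftrightarrow> (\<forall>w. (\<forall>j<m. (\<Sum>i<n. w i * C $$ (i, j)) = 0) \<longrightarrow> (\<forall>i<n. w i = 0))"
proof
  assume rank: "rank C = n"
  obtain ts where ts: "distinct ts" "set ts \<subseteq> set (cols C)" "length ts = n"
    "det (mat_of_cols n ts) \<noteq> 0"
    by (rule full_rank_invertible_selection[OF C rank])
  define N where "N = transpose_mat (mat_of_cols n ts)"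
  have N: "N \<in> carrier_mat n n" "det N \<noteq> 0"
    using ts(3,4) det_transpose[of "mat_of_cols n ts" n] by (auto simp: N_def)
  show "\<forall>w. (\<forall>j<m. (\<Sum>i<n. w i * C $$ (i, j)) = 0) \<longrightarrow> (\<forall>i<n. w i = 0)"
  proof (intro allI impI)
    fix w i assume w: "\<forall>j<m. (\<Sum>i<n. w i * C $$ (i, j)) = 0" and i: "i < n"
    have "N *\<^sub>v vec n w = 0\<^sub>v n"
    proof (rule eq_vecI)
      fix l assume l: "l < dim_vec (0\<^sub>v n)"
      then have "ts ! l \<in> set (cols C)" using ts(2,3) nth_mem by auto
      then obtain c where c: "c < m" "ts ! l = col C c" using C by (auto simp: cols_def)
      have "(N *\<^sub>v vec n w) $ l = (\<Sum>i = 0..<n. C $$ (i, c) * w i)"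
        using l N(1) c C ts(3) by (auto simp: N_def scalar_prod_def mat_of_cols_index intro!: sum.cong)
      then show "(N *\<^sub>v vec n w) $ l = 0\<^sub>v n $ l"
        using w c(1) l by (simp add: mult.commute atLeast0LessThan)
    qed (use N in auto)
    then have "vec n w = 0\<^sub>v n"
      using det_0_iff_vec_prod_zero_field[OF N(1)] N(2) vec_carrier by blast
    then show "w i = 0" using i by (metis index_vec index_zero_vec(1))
  qed
next
  assume ker: "\<forall>w. (\<forall>j<m. (\<Sum>i<n. w i * C $$ (i, j)) = 0) \<longrightarrow> (\<forall>i<n. w i = 0)"
  obtain ts where ts: "distinct ts" "set ts \<subseteq> set (cols C)" "lin_indpt (set ts)"
    "length ts = rank C" "set (cols C) \<subseteq> span (set ts)"
    by (rule rank_independent_columns[OF C])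
  have tV: "set ts \<subseteq> carrier_vec n" using ts(2) cols_dim C by blast
  have le: "rank C \<le> n"
    using li_le_dim(2)[of "set ts"] ts(1,3,4) tV by (simp add: distinct_card dim_is_n)
  show "rank C = n"
  proof (rule ccontr)
    assume "rank C \<noteq> n"
    then have lt: "length ts < n" using le ts(4) by simp
    \<comment> \<open>The selected columns, written as rows and padded with at least one zero row.\<close>
    define N where "N = mat n n (\<lambda>(l, i). if l < length ts then ts ! l $ i else 0)"
    have N: "N \<in> carrier_mat n n" by (simp add: N_def)
    have "(\<Prod>i = 0..<n. N $$ (i, p i)) = 0" if p: "p permutes {0..<n}" for p
    proof -
      have "N $$ (length ts, p (length ts)) = 0"
        using lt permutes_in_image[OF p, of "length ts"] by (simp add: N_def)
      then show ?thesis using lt by (intro prod_zero) auto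
    qed
    then have "det N = 0" unfolding det_def'[OF N] by (intro sum.neutral) auto
    then obtain v where v: "v \<in> carrier_vec n" "v \<noteq> 0\<^sub>v n" "N *\<^sub>v v = 0\<^sub>v n"
      using det_0_iff_vec_prod_zero_field[OF N] by blast
    have "v \<bullet> t = 0" if "t \<in> set ts" for t
    proof -
      obtain l where l: "l < length ts" "t = ts ! l" using \<open>t \<in> set ts\<close> by (metis in_set_conv_nth)
      have t: "t \<in> carrier_vec n" using that tV by blast
      have "(N *\<^sub>v v) $ l = (\<Sum>i = 0..<n. t $ i * v $ i)"
        using l lt v(1) by (auto simp: N_def scalar_prod_def intro!: sum.cong)
      then show ?thesis using v t l lt by (simp add: scalar_prod_def mult.commute)
    qed
    then have "v \<in> orthogonal_complement (span (set ts))"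
      unfolding in_orthogonal_complement_span[OF tV]
      using v(1) by (simp add: orthogonal_complement_def)
    then have orth: "v \<bullet> c = 0" if "c \<in> set (cols C)" for c
      using ts(5) that unfolding orthogonal_complement_def by blast
    have "(\<Sum>i<n. v $ i * C $$ (i, j)) = 0" if "j < m" for j
    proof -
      have "col C j \<in> set (cols C)" using that C by (auto simp: cols_def)
      then have "v \<bullet> col C j = 0" by (rule orth)
      then show ?thesis using C that v(1) by (simp add: scalar_prod_def atLeast0LessThan)
    qed
    then have "\<forall>i<n. v $ i = 0" using ker by blast
    then have "v = 0\<^sub>v n" using v(1) by auto
    then show False using v(2) by simp
  qed
qed

section \<open>Structural controllability as a matching condition\<close>

lemma pow_mat_eq_walk_weight:
  assumes A: "A \<in> carrier_mat n n" and "i < n" "j < n"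
  shows "(A ^\<^sub>m k) $$ (i, j) = walk_weight n (\<lambda>i j. A $$ (i, j)) k i j"
  using assms(3)
proof (induction k arbitrary: j)
  case 0 then show ?case using A assms(2) by simp
next
  case (Suc k)
  have "(A ^\<^sub>m Suc k) $$ (i, j) = (\<Sum>l = 0..<n. (A ^\<^sub>m k) $$ (i, l) * A $$ (l, j))"
    using A assms(2) Suc.prems pow_carrier_mat[OF A, of k] by (simp add: scalar_prod_def)
  also have "\<dots> = (\<Sum>l<n. walk_weight n (\<lambda>i j. A $$ (i, j)) k i l * A $$ (l, j))"
    using Suc.IH by (simp add: atLeast0LessThan)
  also have "\<dots> = walk_weight n (\<lambda>i j. A $$ (i, j)) (Suc k) i j"
    by (rule walk_weight_Suc_right[OF assms(2) Suc.prems, symmetric])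
  finally show ?case .
qed

text \<open>Full row rank of the controllability matrix, read off from its left kernel one block
\<open>A\<^sup>k B\<close> at a time.\<close>
lemma controllable_iff_row_orbit:
  assumes A: "A \<in> carrier_mat n n" and B: "B \<in> carrier_mat n n"
  shows "controllable n A B \<longleftrightarrow>
    (\<forall>w. (\<forall>k<n. \<forall>j<n. (\<Sum>l<n. row_orbit n (\<lambda>i j. A $$ (i, j)) w k l * B $$ (l, j)) = 0)
      \<longrightarrow> (\<forall>i<n. w i = 0))"
proof -
  let ?C = "controllability_mat n A B" and ?r = "row_orbit n (\<lambda>i j. A $$ (i, j))"
  have C: "?C \<in> carrier_mat n (n * n)" by (simp add: controllability_mat_def)
  have entry: "(\<Sum>i<n. w i * (A ^\<^sub>m k * B) $$ (i, j)) = (\<Sum>l<n. ?r w k l * B $$ (l, j))"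
    if "j < n" for w k j
  proof -
    have "(A ^\<^sub>m k * B) $$ (i, j) = (\<Sum>l<n. walk_weight n (\<lambda>i j. A $$ (i, j)) k i l * B $$ (l, j))"
      if "i < n" for i
      using A B \<open>j < n\<close> that pow_carrier_mat[OF A, of k]
      by (simp add: scalar_prod_def pow_mat_eq_walk_weight[OF A, symmetric] atLeast0LessThan)
    then have "(\<Sum>i<n. w i * (A ^\<^sub>m k * B) $$ (i, j))
        = (\<Sum>i<n. \<Sum>l<n. w i * walk_weight n (\<lambda>i j. A $$ (i, j)) k i l * B $$ (l, j))"
      by (intro sum.cong) (simp_all add: sum_distrib_left mult.assoc)
    also have "\<dots> = (\<Sum>l<n. \<Sum>i<n. w i * walk_weight n (\<lambda>i j. A $$ (i, j)) k i l * B $$ (l, j))"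
      by (rule sum.swap)
    finally show ?thesis by (simp add: row_orbit_def sum_distrib_right)
  qed
  have "(\<forall>c<n * n. (\<Sum>i<n. w i * ?C $$ (i, c)) = 0)
      \<longleftrightarrow> (\<forall>k<n. \<forall>j<n. (\<Sum>l<n. ?r w k l * B $$ (l, j)) = 0)" (is "?L \<longleftrightarrow> ?R") for w
  proof
    assume L: ?L
    show ?R
    proof (intro allI impI)
      fix k j assume kj: "k < n" "j < n"
      have "k * n + j < n * n"
      proof -
        have "k * n + j < Suc k * n" using kj by simp
        also have "\<dots> \<le> n * n" using kj(1) by (intro mult_le_mono1) simp
        finally show ?thesis .
      qed
      moreover have "(k * n + j) div n = k" "(k * n + j) mod n = j" using kj by auto
      ultimately show "(\<Sum>l<n. ?r w k l * B $$ (l, j)) = 0"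
        using L[rule_format, of "k * n + j"] entry[OF kj(2), of w k]
        by (simp add: controllability_mat_def)
    qed
  next
    assume R: ?R
    show ?L
    proof (intro allI impI)
      fix c assume c: "c < n * n"
      then have "c div n < n" "c mod n < n"
        by (auto simp: less_mult_imp_div_less) (metis mod_less_divisor mult_is_0 neq0_conv not_less_zero)
      then show "(\<Sum>i<n. w i * ?C $$ (i, c)) = 0"
        using R entry[of "c mod n" w "c div n"] c by (simp add: controllability_mat_def)
    qed
  qed
  then show ?thesis
    unfolding controllable_def vec_space.full_rank_iff_left_kernel_trivial[OF C] by simp
qed

lemma actuation_carrier: "actuation_mat n S \<in> carrier_mat n n"
  by (simp add: actuation_mat_def)

lemma same_structure_actuation_iff:
  assumes A: "A \<in> carrier_mat n n" and A': "A' \<in> carrier_mat n n" and B': "B' \<in> carrier_mat n n"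
  shows "same_structure n A (actuation_mat n S) A' B' \<longleftrightarrow>
    (\<forall>i<n. \<forall>j<n. (A $$ (i, j) = 0 \<longleftrightarrow> A' $$ (i, j) = 0)
      \<and> (B' $$ (i, j) \<noteq> 0 \<longleftrightarrow> i = j \<and> i \<in> S))" (is "?L \<longleftrightarrow> ?R")
proof -
  have app: "append_cols P Q $$ (i, j) = (if j < n then P $$ (i, j) else Q $$ (i, j - n))"
    if "P \<in> carrier_mat n n" "Q \<in> carrier_mat n n" "i < n" "j < 2 * n" for P Q :: "real mat" and i j
    using that by (auto simp: append_cols_def)
  note apps = app[OF A actuation_carrier] app[OF A' B']
  show ?thesis
  proof
    assume L: ?L
    show ?R
    proof (intro allI impI)
      fix i j assume ij: "i < n" "j < n"
      show "(A $$ (i, j) = 0 \<longleftrightarrow> A' $$ (i, j) = 0) \<and> (B' $$ (i, j) \<noteq> 0 \<longleftrightarrow> i = j \<and> i \<in> S)"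
        using L[unfolded same_structure_def, rule_format, of i j]
          L[unfolded same_structure_def, rule_format, of i "n + j"] ij
        by (simp add: apps) (simp add: actuation_mat_def split: if_splits)
    qed
  next
    assume R: ?R
    show ?L unfolding same_structure_def
    proof (intro allI impI)
      fix i j assume ij: "i < n" "j < 2 * n"
      show "append_cols A (actuation_mat n S) $$ (i, j) = 0 \<longleftrightarrow> append_cols A' B' $$ (i, j) = 0"
      proof (cases "j < n")
        case True
        then show ?thesis using R ij apps by simp
      next
        case False
        then have jn: "j - n < n" using ij by simp
        have act: "actuation_mat n S $$ (i, j - n) = (if i = j - n \<and> i \<in> S then 1 else 0)"
          using ij jn by (simp add: actuation_mat_def)
        show ?thesis using R[rule_format, of i "j - n"] ij jn False
          by (auto simp: apps act)
      qed
    qed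
  qed
qed

definition pattern :: "nat \<Rightarrow> real mat \<Rightarrow> (nat \<times> nat) set" where
  "pattern n A = {(i, j). i < n \<and> j < n \<and> A $$ (i, j) \<noteq> 0}"

text \<open>A row vector killed by \<open>A'\<close> and \<open>B'\<close> has zero orbit from time \<open>1\<close> on, and contributes nothing
at time \<open>0\<close>, so controllability forces it to vanish. Hence \<open>[A' B']\<close> has full row rank and a
transversal of nonzero entries, which lies in \<open>A'\<close> in the rows outside \<open>S\<close>.\<close>
lemma structurally_controllable_imp_matchable:
  assumes A: "A \<in> carrier_mat n n" and n: "n \<ge> 1"
    and sc: "structurally_controllable n A (actuation_mat n S)"
  shows "S \<noteq> {} \<and> matchable (pattern n A) ({..<n} - S)"
proof -
  obtain A' B' where A': "A' \<in> carrier_mat n n" and B': "B' \<in> carrier_mat n n"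
    and str: "same_structure n A (actuation_mat n S) A' B'" and con: "controllable n A' B'"
    using sc by (auto simp: structurally_controllable_def)
  have Az: "A $$ (i, j) = 0 \<longleftrightarrow> A' $$ (i, j) = 0"
    and Bz: "B' $$ (i, j) \<noteq> 0 \<longleftrightarrow> i = j \<and> i \<in> S" if "i < n" "j < n" for i j
    using str that unfolding same_structure_actuation_iff[OF A A' B'] by blast+
  let ?r = "row_orbit n (\<lambda>i j. A' $$ (i, j))"
  have con': "w i = 0"
    if "\<And>k j. k < n \<Longrightarrow> j < n \<Longrightarrow> (\<Sum>l<n. ?r w k l * B' $$ (l, j)) = 0" "i < n" for w i
    using con that unfolding controllable_iff_row_orbit[OF A' B'] by blast
  have "S \<noteq> {}"
  proof
    assume "S = {}"
    then have "(\<Sum>l<n. ?r (\<lambda>_. 1) k l * B' $$ (l, j)) = 0" if "j < n" for k j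
      using Bz that by (intro sum.neutral) auto
    then have "(1::real) = 0" using con'[of "\<lambda>_. 1" 0] n by simp
    then show False by simp
  qed
  moreover have "matchable (pattern n A) ({..<n} - S)"
  proof -
    define M where "M = mat n (n + n) (\<lambda>(i, c). if c < n then A' $$ (i, c) else B' $$ (i, c - n))"
    have M: "M \<in> carrier_mat n (n + n)" by (simp add: M_def)
    have "w i = 0" if w: "\<forall>c<n + n. (\<Sum>i<n. w i * M $$ (i, c)) = 0" and i: "i < n" for w i
    proof (rule con'[OF _ i])
      fix k j assume kj: "k < n" "j < n"
      have wA: "(\<Sum>i<n. w i * A' $$ (i, c)) = 0" if "c < n" for c
        using w[rule_format, of c] that by (simp add: M_def)
      have wB: "(\<Sum>i<n. w i * B' $$ (i, j)) = 0"
        using w[rule_format, of "n + j"] kj(2) by (simp add: M_def)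
      have "?r w 1 c = 0" if "c < n" for c
        using wA[OF that] that by (simp add: row_orbit_Suc row_orbit_0)
      then have r: "?r w (Suc l) c = 0" if "c < n" for l c
        using that by (induction l arbitrary: c) (auto simp: row_orbit_Suc)
      show "(\<Sum>l<n. ?r w k l * B' $$ (l, j)) = 0"
      proof (cases k)
        case 0 then show ?thesis using wB by (simp add: row_orbit_0)
      next
        case (Suc l) then show ?thesis using r by simp
      qed
    qed
    then have "vec_space.rank n M = n"
      unfolding vec_space.full_rank_iff_left_kernel_trivial[OF M] by blast
    from vec_space.full_rank_transversal[OF M this] obtain h where
      h: "inj_on h {..<n}" "\<forall>i<n. h i < n + n \<and> M $$ (i, h i) \<noteq> 0" by blast
    have "(i, h i) \<in> pattern n A" if i: "i \<in> {..<n} - S" for i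
    proof -
      have hi: "h i < n + n" "M $$ (i, h i) \<noteq> 0" "i < n" using h(2) i by auto
      have "h i < n"
      proof (rule ccontr)
        assume "\<not> h i < n"
        then have "B' $$ (i, h i - n) \<noteq> 0" "h i - n < n" using hi by (auto simp: M_def)
        then show False using Bz[of i "h i - n"] hi i by auto
      qed
      then show ?thesis using hi Az[of i "h i"] by (simp add: M_def pattern_def)
    qed
    then show ?thesis unfolding matchable_def
      using inj_on_subset[OF h(1), of "{..<n} - S"] by blast
  qed
  ultimately show ?thesis by blast
qed

text \<open>Strong connectivity enters only through the edge that it gives out of every proper nonempty
vertex set.\<close>
lemma structurally_controllable_if_matchable:
  assumes A: "A \<in> carrier_mat n n" and S: "S \<subseteq> {..<n}" "S \<noteq> {}"
    and conn: "strongly_connected (with_proj (matrix_digraph n A))"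
    and mat: "matchable (pattern n A) ({..<n} - S)"
  shows "structurally_controllable n A (actuation_mat n S)"
proof -
  have cross: "\<exists>u\<in>U. \<exists>v\<in>{..<n} - U. (v, u) \<in> pattern n A" if U: "U \<noteq> {}" "U \<subset> {..<n}" for U
  proof (rule ccontr)
    assume no: "\<not> ?thesis"
    obtain u v where uv: "u \<in> U" "v \<in> {..<n} - U" using U by blast
    have "u \<rightarrow>\<^sup>*\<^bsub>with_proj (matrix_digraph n A)\<^esub> v"
      using conn uv U unfolding strongly_connected_def by (auto simp: matrix_digraph_def)
    then have "(u, v) \<in> rtrancl_on {..<n} {(j, i). i < n \<and> j < n \<and> A $$ (i, j) \<noteq> 0}"
      unfolding reachable_def by (simp add: matrix_digraph_def)
    then have "v \<in> U"
    proof (induction rule: rtrancl_on_induct)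
      case (step y z)
      then show ?case using no by (auto simp: pattern_def)
    qed (use uv in auto)
    then show False using uv by simp
  qed
  have E: "pattern n A \<subseteq> {..<n} \<times> {..<n}" by (auto simp: pattern_def)
  obtain a where a: "\<forall>i j. a i j \<noteq> 0 \<longrightarrow> (i, j) \<in> pattern n A" "separates n a S {..<n}"
    using ex_separating_weights[OF E cross S(2,1)] mat unfolding matchable_def by blast
  obtain b where b: "separates n b S {..<n}" "\<forall>i<n. \<forall>j<n. b i j = 0 \<longleftrightarrow> A $$ (i, j) = 0"
    using separates_perturb[OF S(1) a(2), of "\<lambda>i j. A $$ (i, j)"] a(1)
    by (auto simp: pattern_def)
  define A' where "A' = mat n n (\<lambda>(i, j). b i j)"
  have A': "A' \<in> carrier_mat n n" by (simp add: A'_def)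
  have walk: "walk_weight n (\<lambda>i j. A' $$ (i, j)) k i j = walk_weight n b k i j"
    if "i < n" for k i j
    using that by (induction k arbitrary: i) (auto simp: A'_def intro!: sum.cong)
  have orb: "row_orbit n (\<lambda>i j. A' $$ (i, j)) = row_orbit n b"
    by (intro ext) (simp add: row_orbit_def walk)
  have "controllable n A' (actuation_mat n S)"
    unfolding controllable_iff_row_orbit[OF A' actuation_carrier] orb
  proof (intro allI impI)
    fix w i
    assume w: "\<forall>k<n. \<forall>j<n. (\<Sum>l<n. row_orbit n b w k l * actuation_mat n S $$ (l, j)) = 0"
      and i: "i < n"
    have "row_orbit n b w k s = 0" if ks: "k < n" "s \<in> S" for k s
    proof -
      have s: "s < n" using ks S by auto
      have "(\<Sum>l<n. row_orbit n b w k l * actuation_mat n S $$ (l, s))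
          = (\<Sum>l<n. if l = s then row_orbit n b w k l else 0)"
        using s ks by (intro sum.cong) (auto simp: actuation_mat_def)
      then show ?thesis using w ks(1) s by (simp add: sum.delta)
    qed
    then have "row_orbit n b w k s = 0" if "s \<in> S" for k s
      using row_orbit_zero_if_zero_below[OF S(1)] that by blast
    then show "w i = 0" using b(1) i unfolding separates_def by blast
  qed
  moreover have "same_structure n A (actuation_mat n S) A' (actuation_mat n S)"
    unfolding same_structure_actuation_iff[OF A A' actuation_carrier]
    using b(2) by (simp add: A'_def actuation_mat_def)
  ultimately show ?thesis
    unfolding structurally_controllable_def using A' actuation_carrier by blast
qed

section \<open>The matroid\<close>

theorem proposition1:
  fixes n K :: nat and A :: "real mat"
  assumes "n \<ge> 1"
    and "A \<in> carrier_mat n n"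
    and "strongly_connected (with_proj (matrix_digraph n A))"
    and "controlling_sets n A K \<noteq> {}"
  shows "matroid {..<n} (controlling_subsets n A K)"
proof -
  have char: "S \<in> controlling_sets n A K \<longleftrightarrow>
      S \<subseteq> {..<n} \<and> card S = K \<and> S \<noteq> {} \<and> matchable (pattern n A) ({..<n} - S)" for S
    using structurally_controllable_imp_matchable[OF assms(2,1)]
      structurally_controllable_if_matchable[OF assms(2) _ _ assms(3)]
    unfolding controlling_sets_def by blast
  show ?thesis unfolding controlling_subsets_def
  proof (rule matroid_if_basis_exchange[where K = K])
    fix S T z assume S: "S \<in> controlling_sets n A K" and T: "T \<in> controlling_sets n A K"
      and z: "z \<in> S - T"
    have S': "S \<subseteq> {..<n}" "card S = K" and T': "T \<subseteq> {..<n}" "card T = K"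
      using S T char by auto
    have fin: "finite S" "finite T" using S' T' finite_subset by blast+
    have "card ({..<n} - S) = card ({..<n} - T)" using S' T' fin by (simp add: card_Diff_subset)
    moreover have "z \<in> ({..<n} - T) - ({..<n} - S)" using z S' by auto
    ultimately obtain t where t: "t \<in> ({..<n} - S) - ({..<n} - T)"
      "matchable (pattern n A) (insert z (({..<n} - S) - {t}))"
      using matchable_exchange[of "{..<n} - S" "{..<n} - T" "pattern n A" z] S T char by auto
    have tS: "t \<in> T - S" using t(1) by auto
    have "insert z (({..<n} - S) - {t}) = {..<n} - insert t (S - {z})" using z S' tS by auto
    moreover have "card (insert t (S - {z})) = K"
    proof -
      have "card (insert t (S - {z})) = Suc (card (S - {z}))" using tS fin by simp
      also have "\<dots> = card S" using z by (intro card_Suc_Diff1) (use fin in auto)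
      finally show ?thesis using S' by simp
    qed
    moreover have "insert t (S - {z}) \<subseteq> {..<n}" using tS S' T' by auto
    ultimately have "insert t (S - {z}) \<in> controlling_sets n A K" using t(2) char by simp
    then show "\<exists>t\<in>T - S. insert t (S - {z}) \<in> controlling_sets n A K" using tS by blast
  qed (use char assms(4) in auto)
qed

end
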